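(* Let $x\in[0,1)$, $\mu:[0,\infty)\to\mathbb R$, $\lambda:[0,\infty)\to[0,\infty)$, let $\pi$ be a probability measure on the type set $\Theta$, and fix a contract $(p,\alpha,\beta)$ with $p\in[0,\infty)$. Assume: (U1) there is a maximal effort $E_{\max}<\infty$, so that all efforts and the mean-field effort $\tilde m$ are restricted to $[0,E_{\max}]$; (U2) $\mu,\lambda$ are continuous and strictly convex on $[0,(1+x)E_{\max}]$, and Lipschitz there: there exist $L_\mu,L_\lambda>0$ with $|\mu(z_1)-\mu(z_2)|\le L_\mu|z_1-z_2|$ and $|\lambda(z_1)-\lambda(z_2)|\le L_\lambda|z_1-z_2|$ for all $z_1,z_2$ in this interval; (U3) there exist constants $0<\gamma_{\min}<\gamma_{\max}<\infty$, $0<c_{\max}<\infty$, $0<\sigma_{\min}<\sigma_{\max}<\infty$ such that $\Theta=[\gamma_{\min},\gamma_{\max}]\times[0,c_{\max}]\times[\sigma_{\min},\sigma_{\max}]$, with $\theta=(\gamma,c,\sigma)$; (U4) $\alpha>0$ and $\beta\in[0,1)$; (U5) $\pi$ admits a density $f$ with respect to Lebesgue measure on $\Theta$ with $\|f\|_\infty\le C_f<\infty$; (U6) with $$c_\sigma:=\gamma_{\min}\alpha^2\sigma_{\min},\qquad C_m:=x\Big(2c_{\max}+\alpha+(2-\beta)L_\mu+\tfrac12\gamma_{\max}\big((1-\beta)^2+1\big)L_\lambda\Big),\qquad C_q:=\frac{C_f}{c_\sigma}(\gamma_{\max}-\gamma_{\min})\,c_{\max}\,C_m,$$ one has $3x+E_{\max}C_q<1$.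 Then: (i) for each $\theta\in\Theta$ and each $\tilde m\in[0,E_{\max}]$, the optimal effort levels $e^{\mathrm{in}}(\theta;\tilde m)$ and $e^{\mathrm{out}}(\theta;\tilde m)$ are uniquely defined (i.e. $E^{\mathrm{in}}(\theta;\tilde m)$ and $E^{\mathrm{out}}(\theta;\tilde m)$ are singletons); (ii) the map $\Phi:[0,E_{\max}]\to[0,E_{\max}]$, $$\Phi(\tilde m)=\int_\Theta\big[q(\theta;\tilde m)e^{\mathrm{in}}(\theta;\tilde m)+(1-q(\theta;\tilde m))e^{\mathrm{out}}(\theta;\tilde m)\big]\,d\pi(\theta),$$ where $q(\cdot;\tilde m)$ is any measurable participation probability obeying the participation rule at $\tilde m$, is well defined (independent of the choice of $q$) and Lipschitz continuous on $[0,E_{\max}]$ with Lipschitz constant $<1$; in particular it is a contraction of the complete metric space $[0,E_{\max}]$, and there exists a unique $\tilde m^*\in[0,E_{\max}]$ with $\tilde m^*=\Phi(\tilde m^* )$; (iii) the associated mixed-participation mean-field Nash equilibrium is unique up to $\pi$-a.e. equality, and hence all aggregate equilibrium quantities (the mean effort $\tilde m^*$ and the $\pi$-integrals of the equilibrium objects) are unique.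
   Context: For $e,\tilde m\in[0,E_{\max}]$ and $\theta=(\gamma,c,\sigma)\in\Theta$ define the certainty-equivalent costs $$\mathrm{CE}^{\mathrm{out}}(e;\theta,\tilde m)=\mu(e+x\tilde m)+c\,e+\tfrac12\gamma\lambda(e+x\tilde m),$$ $$\mathrm{CE}^{\mathrm{in}}(e;\theta,\tilde m)=p+(c-\alpha)e+\tfrac12\gamma\alpha^2\sigma^2+(1-\beta)\mu(e+x\tilde m)+\tfrac12\gamma(1-\beta)^2\lambda(e+x\tilde m),$$ and the utilities $U^{\mathrm{out}}=-\exp\{\gamma\,\mathrm{CE}^{\mathrm{out}}\}$, $U^{\mathrm{in}}=-\exp\{\gamma\,\mathrm{CE}^{\mathrm{in}}\}$. The optimal-effort sets are $$E^{\mathrm{out}}(\theta;\tilde m)=\arg\min_{e\in[0,E_{\max}]}\mathrm{CE}^{\mathrm{out}}(e;\theta,\tilde m),\qquad E^{\mathrm{in}}(\theta;\tilde m)=\arg\min_{e\in[0,E_{\max}]}\mathrm{CE}^{\mathrm{in}}(e;\theta,\tilde m),$$ and $e^{\mathrm{out}}(\theta;\tilde m)\in E^{\mathrm{out}}(\theta;\tilde m)$, $e^{\mathrm{in}}(\theta;\tilde m)\in E^{\mathrm{in}}(\theta;\tilde m)$ denote optimal efforts. Participation rule at $\tilde m$: $q(\cdot;\tilde m):\Theta\to[0,1]$ is measurable, $q(\theta;\tilde m)=1$ if $U^{\mathrm{in}}(e^{\mathrm{in}}(\theta;\tilde m);\theta,\tilde m)>U^{\mathrm{out}}(e^{\mathrm{out}}(\theta;\tilde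 m);\theta,\tilde m)$, $q(\theta;\tilde m)=0$ if the strict inequality is reversed, and $q(\theta;\tilde m)$ is an arbitrary value in $[0,1]$ in case of equality. A tuple $(\tilde m,\{e^{\mathrm{in}}(\theta;\tilde m),e^{\mathrm{out}}(\theta;\tilde m),q(\theta;\tilde m)\}_{\theta\in\Theta})$, with $\tilde m\in[0,E_{\max}]$ and components measurable in $\theta$, is a (mixed-participation) mean-field Nash equilibrium if (1) $e^{\mathrm{out}}(\theta;\tilde m)\in E^{\mathrm{out}}(\theta;\tilde m)$ and $e^{\mathrm{in}}(\theta;\tilde m)\in E^{\mathrm{in}}(\theta;\tilde m)$ for every $\theta$; (2) $q(\cdot;\tilde m)$ satisfies the participation rule at $\tilde m$; (3) $\tilde m=\int_\Theta[q(\theta;\tilde m)e^{\mathrm{in}}(\theta;\tilde m)+(1-q(\theta;\tilde m))e^{\mathrm{out}}(\theta;\tilde m)]\,d\pi(\theta)$. "Unique up to $\pi$-a.e. equality" means that any two equilibria have the same $\tilde m$ and their functions $e^{\mathrm{in}},e^{\mathrm{out}},q$ coincide for $\pi$-a.e. $\theta$. *)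

theory Defs
  imports "HOL-Probability.Probability_Measure" "HOL-Probability.Essential_Supremum"
begin

type_synonym agent = "real \<times> real \<times> real"

definition strictly_convex_on :: "real set \<Rightarrow> (real \<Rightarrow> real) \<Rightarrow> bool" where
  "strictly_convex_on S g \<longleftrightarrow> convex S \<and>
     (\<forall>y\<in>S. \<forall>z\<in>S. \<forall>t. y \<noteq> z \<longrightarrow> 0 < t \<longrightarrow> t < 1 \<longrightarrow>
        g ((1 - t) * y + t * z) < (1 - t) * g y + t * g z)"

text \<open>Types are triples \<open>(\<gamma>, c, \<sigma>)\<close>; \<open>m\<close> is the mean-field effort and
  \<open>lam\<close> is the function written \<open>\<lambda>\<close> on paper.\<close>

definition CE_out ::
  "(real \<Rightarrow> real) \<Rightarrow> (real \<Rightarrow> real) \<Rightarrow> real \<Rightarrow> agent \<Rightarrow> real \<Rightarrow> real \<Rightarrow> real" where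
  "CE_out \<mu> lam x = (\<lambda>(\<gamma>, c, \<sigma>) m e.
     \<mu> (e + x * m) + c * e + 1/2 * \<gamma> * lam (e + x * m))"

definition CE_in ::
  "(real \<Rightarrow> real) \<Rightarrow> (real \<Rightarrow> real) \<Rightarrow> real \<Rightarrow> real \<Rightarrow> real \<Rightarrow> real \<Rightarrow> agent \<Rightarrow> real \<Rightarrow> real \<Rightarrow> real" where
  "CE_in \<mu> lam x p \<alpha> \<beta> = (\<lambda>(\<gamma>, c, \<sigma>) m e.
     p + (c - \<alpha>) * e + 1/2 * \<gamma> * \<alpha>\<^sup>2 * \<sigma>\<^sup>2
       + (1 - \<beta>) * \<mu> (e + x * m) + 1/2 * \<gamma> * (1 - \<beta>)\<^sup>2 * lam (e + x * m))"

definition U_out ::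
  "(real \<Rightarrow> real) \<Rightarrow> (real \<Rightarrow> real) \<Rightarrow> real \<Rightarrow> agent \<Rightarrow> real \<Rightarrow> real \<Rightarrow> real" where
  "U_out \<mu> lam x \<theta> m e = - exp (fst \<theta> * CE_out \<mu> lam x \<theta> m e)"

definition U_in ::
  "(real \<Rightarrow> real) \<Rightarrow> (real \<Rightarrow> real) \<Rightarrow> real \<Rightarrow> real \<Rightarrow> real \<Rightarrow> real \<Rightarrow> agent \<Rightarrow> real \<Rightarrow> real \<Rightarrow> real" where
  "U_in \<mu> lam x p \<alpha> \<beta> \<theta> m e = - exp (fst \<theta> * CE_in \<mu> lam x p \<alpha> \<beta> \<theta> m e)"

definition E_out ::
  "(real \<Rightarrow> real) \<Rightarrow> (real \<Rightarrow> real) \<Rightarrow> real \<Rightarrow> real \<Rightarrow> agent \<Rightarrow> real \<Rightarrow> real set" where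
  "E_out \<mu> lam x Emax \<theta> m = {e. is_arg_min (CE_out \<mu> lam x \<theta> m) (\<lambda>e. e \<in> {0..Emax}) e}"

definition E_in ::
  "(real \<Rightarrow> real) \<Rightarrow> (real \<Rightarrow> real) \<Rightarrow> real \<Rightarrow> real \<Rightarrow> real \<Rightarrow> real \<Rightarrow> real \<Rightarrow> agent \<Rightarrow> real \<Rightarrow> real set" where
  "E_in \<mu> lam x Emax p \<alpha> \<beta> \<theta> m =
     {e. is_arg_min (CE_in \<mu> lam x p \<alpha> \<beta> \<theta> m) (\<lambda>e. e \<in> {0..Emax}) e}"

text \<open>The optimal efforts are meaningful only when the optimal-effort sets are singletons.\<close>

definition e_out ::
  "(real \<Rightarrow> real) \<Rightarrow> (real \<Rightarrow> real) \<Rightarrow> real \<Rightarrow> real \<Rightarrow> agent \<Rightarrow> real \<Rightarrow> real" where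
  "e_out \<mu> lam x Emax \<theta> m = the_elem (E_out \<mu> lam x Emax \<theta> m)"

definition e_in ::
  "(real \<Rightarrow> real) \<Rightarrow> (real \<Rightarrow> real) \<Rightarrow> real \<Rightarrow> real \<Rightarrow> real \<Rightarrow> real \<Rightarrow> real \<Rightarrow> agent \<Rightarrow> real \<Rightarrow> real" where
  "e_in \<mu> lam x Emax p \<alpha> \<beta> \<theta> m = the_elem (E_in \<mu> lam x Emax p \<alpha> \<beta> \<theta> m)"

text \<open>In the next two definitions \<open>ei\<close>, \<open>eo\<close> and \<open>q\<close> are functions of the type alone
  (effort inside, effort outside and participation probability at the given \<open>m\<close>), and the
  type set is the space of the type distribution \<open>\<pi>\<close>.\<close>

definition participation_rule ::
  "(real \<Rightarrow> real) \<Rightarrow> (real \<Rightarrow> real) \<Rightarrow> real \<Rightarrow> real \<Rightarrow> real \<Rightarrow> real \<Rightarrow> agent measure \<Rightarrow>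
   real \<Rightarrow> (agent \<Rightarrow> real) \<Rightarrow> (agent \<Rightarrow> real) \<Rightarrow> (agent \<Rightarrow> real) \<Rightarrow> bool" where
  "participation_rule \<mu> lam x p \<alpha> \<beta> \<pi> m ei eo q \<longleftrightarrow>
     q \<in> borel_measurable \<pi> \<and>
     (\<forall>\<theta>\<in>space \<pi>.
        q \<theta> \<in> {0..1} \<and>
        (U_in \<mu> lam x p \<alpha> \<beta> \<theta> m (ei \<theta>) > U_out \<mu> lam x \<theta> m (eo \<theta>) \<longrightarrow> q \<theta> = 1) \<and>
        (U_in \<mu> lam x p \<alpha> \<beta> \<theta> m (ei \<theta>) < U_out \<mu> lam x \<theta> m (eo \<theta>) \<longrightarrow> q \<theta> = 0))"

definition mean_field_equilibrium ::
  "(real \<Rightarrow> real) \<Rightarrow> (real \<Rightarrow> real) \<Rightarrow> real \<Rightarrow> real \<Rightarrow> real \<Rightarrow> real \<Rightarrow> real \<Rightarrow> agent measure \<Rightarrow>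
   real \<Rightarrow> (agent \<Rightarrow> real) \<Rightarrow> (agent \<Rightarrow> real) \<Rightarrow> (agent \<Rightarrow> real) \<Rightarrow> bool" where
  "mean_field_equilibrium \<mu> lam x Emax p \<alpha> \<beta> \<pi> m ei eo q \<longleftrightarrow>
     m \<in> {0..Emax} \<and>
     ei \<in> borel_measurable \<pi> \<and> eo \<in> borel_measurable \<pi> \<and>
     (\<forall>\<theta>\<in>space \<pi>. eo \<theta> \<in> E_out \<mu> lam x Emax \<theta> m \<and> ei \<theta> \<in> E_in \<mu> lam x Emax p \<alpha> \<beta> \<theta> m) \<and>
     participation_rule \<mu> lam x p \<alpha> \<beta> \<pi> m ei eo q \<and>
     m = (\<integral>\<theta>. q \<theta> * ei \<theta> + (1 - q \<theta>) * eo \<theta> \<partial>\<pi>)"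

end

theory Submission
  imports Defs
begin

text \<open>
  With \<open>z = e + x m\<close>, an optimal effort minimises a fixed strictly convex function of \<open>z\<close> over
  the window \<open>[x m, x m + Emax]\<close>; translating the window by \<open>d\<close> moves the optimal effort by
  at most \<open>\<bar>d\<bar>\<close>, so efforts are \<open>x\<close>-Lipschitz in \<open>m\<close>. The cost gap between
  participating and not participating is \<open>C_m\<close>-Lipschitz in \<open>m\<close>, and it depends on \<open>\<sigma>\<close> only through
  \<open>\<gamma> \<alpha>\<^sup>2 \<sigma>\<^sup>2 / 2\<close>, whose slope is at least \<open>c_sigma\<close>. By Fubini the types whose decision can
  differ between \<open>m\<close> and \<open>m'\<close> have mass at most \<open>C_q \<bar>m - m'\<bar>\<close>; for \<open>m = m'\<close> this says that
  indifferent types are negligible. Hence the aggregate effort is Lipschitz with constant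
  \<open>x + Emax C_q < 1\<close>, and Banach's fixed point theorem applies.
\<close>

section \<open>Strictly convex functions and their minimisers\<close>

text \<open>Both \<open>u\<close> and \<open>v\<close> are convex combinations of \<open>y\<close>
  and \<open>z\<close>, with the two weights interchanged, so the two strict convexity inequalities
  add up to the claim. The case \<open>u = v\<close> is midpoint convexity.\<close>

lemma strictly_convex_on_four_point:
  assumes "strictly_convex_on S h" "y \<in> S" "z \<in> S"
    and "y < u" "u < z" "u + v = y + z"
  shows "h u + h v < h y + h z"
proof -
  define t where "t = (u - y) / (z - y)"
  have yz: "z - y > 0" using assms by simp
  have t: "0 < t" "t < 1" using assms by (auto simp: t_def field_simps)
  have "t * (z - y) = u - y" using yz by (simp add: t_def)
  hence u: "u = (1 - t) * y + t * z" by (simp add: algebra_simps)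
  have "v = y + z - u" using assms by simp
  hence v: "v = (1 - (1 - t)) * y + (1 - t) * z" unfolding u by (simp add: algebra_simps)
  have conv: "h ((1 - s) * y + s * z) < (1 - s) * h y + s * h z" if "0 < s" "s < 1" for s
    using assms that unfolding strictly_convex_on_def by auto
  have "h u < (1 - t) * h y + t * h z" using conv[of t] t u by simp
  moreover have "h v < t * h y + (1 - t) * h z" using conv[of "1 - t"] t v by simp
  moreover have "(1 - t) * h y + t * h z + (t * h y + (1 - t) * h z) = h y + h z"
    by (simp add: algebra_simps)
  ultimately show ?thesis by linarith
qed

lemma strictly_convex_on_affine_combination:
  assumes "strictly_convex_on S g" "strictly_convex_on S h" "0 < a" "0 < b"
  shows "strictly_convex_on S (\<lambda>z. k + l * z + a * g z + b * h z)"
  unfolding strictly_convex_on_def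
proof (intro conjI ballI allI impI)
  show "convex S" using assms(1) by (simp add: strictly_convex_on_def)
next
  fix y z t :: real
  assume *: "y \<in> S" "z \<in> S" "y \<noteq> z" "0 < t" "t < 1"
  let ?w = "(1 - t) * y + t * z"
  have "a * g ?w < a * ((1 - t) * g y + t * g z)"
    using assms * by (simp add: strictly_convex_on_def)
  moreover have "b * h ?w < b * ((1 - t) * h y + t * h z)"
    using assms * by (simp add: strictly_convex_on_def)
  ultimately show "k + l * ?w + a * g ?w + b * h ?w
      < (1 - t) * (k + l * y + a * g y + b * h y) + t * (k + l * z + a * g z + b * h z)"
    by (simp add: algebra_simps)
qed

text \<open>Two monotonicity facts combine: when the window moves right, the minimising position
  \<open>e + s\<close> does not move left, and the effort \<open>e\<close>, measured from the left
  end of the window, does not grow. For \<open>s < s'\<close> this gives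
  \<open>0 \<le> e - e'\<close> and \<open>e - e' \<le> s' - s\<close>.\<close>

lemma argmin_translate_lipschitz:
  fixes h :: "real \<Rightarrow> real"
  assumes conv: "strictly_convex_on {0..B} h"
    and "0 \<le> s" "s + E \<le> B" "0 \<le> s'" "s' + E \<le> B"
    and "is_arg_min (\<lambda>e. h (e + s)) (\<lambda>e. e \<in> {0..E}) e"
    and "is_arg_min (\<lambda>e. h (e + s')) (\<lambda>e. e \<in> {0..E}) e'"
  shows "\<bar>e - e'\<bar> \<le> \<bar>s - s'\<bar>"
proof -
  have aux: "e + s \<le> e' + s' \<and> (s < s' \<longrightarrow> e' \<le> e)"
    if le: "s \<le> s'" and dom: "0 \<le> s" "s + E \<le> B" "0 \<le> s'" "s' + E \<le> B"
      and m: "is_arg_min (\<lambda>e. h (e + s)) (\<lambda>e. e \<in> {0..E}) e"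
      and m': "is_arg_min (\<lambda>e. h (e + s')) (\<lambda>e. e \<in> {0..E}) e'" for s s' e e'
  proof -
    have e: "0 \<le> e" "e \<le> E" "0 \<le> e'" "e' \<le> E"
      using m m' by (auto simp: is_arg_min_def)
    have opt: "h (e + s) \<le> h z" if "s \<le> z" "z \<le> s + E" for z
    proof -
      have "z - s \<in> {0..E}" using that by auto
      hence "\<not> h (z - s + s) < h (e + s)" using m unfolding is_arg_min_def by blast
      thus ?thesis by simp
    qed
    have opt': "h (e' + s') \<le> h z" if "s' \<le> z" "z \<le> s' + E" for z
    proof -
      have "z - s' \<in> {0..E}" using that by auto
      hence "\<not> h (z - s' + s') < h (e' + s')" using m' unfolding is_arg_min_def by blast
      thus ?thesis by simp
    qed
    \<comment> \<open>If the position moved left, the midpoint of the two positions would lie in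
      both windows, so neither minimal value could exceed the value there, against strict
      convexity.\<close>
    have "\<not> e' + s' < e + s"
    proof
      assume less: "e' + s' < e + s"
      let ?w = "(e + s + (e' + s')) / 2"
      have "h ?w + h ?w < h (e' + s') + h (e + s)"
        using strictly_convex_on_four_point[OF conv, of "e' + s'" "e + s" ?w ?w] less e dom le
        by (auto simp: field_simps)
      moreover have "h (e + s) \<le> h ?w" using less e le by (intro opt) (auto simp: field_simps)
      moreover have "h (e' + s') \<le> h ?w" using less e le by (intro opt') (auto simp: field_simps)
      ultimately show False by linarith
    qed
    \<comment> \<open>Exchanging the two efforts keeps both feasible and puts the new positions
      strictly between the old ones with the same sum; this would lower the sum of the two
      minima.\<close>
    moreover have "\<not> e < e'" if "s < s'"
    proof
      assume less: "e < e'"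
      have "h (e + s') + h (e' + s) < h (e + s) + h (e' + s')"
        using strictly_convex_on_four_point[OF conv, of "e + s" "e' + s'" "e + s'" "e' + s"]
          less e dom that by auto
      moreover have "h (e + s) \<le> h (e' + s)" using e by (intro opt) auto
      moreover have "h (e' + s') \<le> h (e + s')" using e by (intro opt') auto
      ultimately show False by linarith
    qed
    ultimately show ?thesis by linarith
  qed
  \<comment> \<open>For \<open>s = s'\<close> the first fact, used in both directions, gives
    \<open>e = e'\<close>.\<close>
  show ?thesis
    using aux[of s s' e e'] aux[of s' s e' e] assms by linarith
qed

text \<open>Closed graph theorem for maps into a compact set: by uniqueness the graph of
  \<open>g\<close> consists of all pairs that do at least as well as every competitor in
  \<open>K\<close>, which is an intersection of closed conditions.\<close>

lemma continuous_on_unique_argmin: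
  fixes F :: "'a::euclidean_space \<Rightarrow> 'b::euclidean_space \<Rightarrow> real"
  assumes "closed S" "compact K"
    and cont: "continuous_on (S \<times> K) (\<lambda>z. F (fst z) (snd z))"
    and min: "\<And>s. s \<in> S \<Longrightarrow> is_arg_min (F s) (\<lambda>k. k \<in> K) (g s)"
    and uniq: "\<And>s k. s \<in> S \<Longrightarrow> is_arg_min (F s) (\<lambda>k. k \<in> K) k \<Longrightarrow> k = g s"
  shows "continuous_on S g"
proof (rule continuous_from_closed_graph[OF \<open>compact K\<close>])
  show gK: "g \<in> S \<rightarrow> K" using min by (auto simp: is_arg_min_def)
  have "(\<lambda>s. (s, g s)) ` S =
      (S \<times> K) \<inter> (\<Inter>k\<in>K. {z \<in> S \<times> K. F (fst z) (snd z) \<le> F (fst z) k})" (is "_ = ?R")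
  proof (intro set_eqI iffI)
    fix z assume "z \<in> (\<lambda>s. (s, g s)) ` S"
    thus "z \<in> ?R" using min gK by (auto simp: is_arg_min_linorder)
  next
    fix z assume z: "z \<in> ?R"
    obtain s k where sk: "z = (s, k)" by fastforce
    have "s \<in> S" "k \<in> K" "\<forall>k'\<in>K. F s k \<le> F s k'" using z unfolding sk by simp_all
    moreover from this have "k = g s" by (intro uniq) (simp_all add: is_arg_min_linorder)
    ultimately show "z \<in> (\<lambda>s. (s, g s)) ` S" using sk by simp
  qed
  moreover have "closed ?R"
  proof (intro closed_Int closed_INT ballI closed_Times)
    fix k assume "k \<in> K"
    have "continuous_on (S \<times> K) ((\<lambda>z. F (fst z) (snd z)) \<circ> (\<lambda>z. (fst z, k)))"
      by (intro continuous_on_compose continuous_intros continuous_on_subset[OF cont])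
        (use \<open>k \<in> K\<close> in auto)
    hence "continuous_on (S \<times> K) (\<lambda>z. F (fst z) k)" by (simp add: o_def)
    thus "closed {z \<in> S \<times> K. F (fst z) (snd z) \<le> F (fst z) k}"
      using assms by (intro continuous_on_closed_Collect_le cont closed_Times)
        (auto intro: compact_imp_closed)
  qed (use assms compact_imp_closed in auto)
  ultimately show "closed ((\<lambda>s. (s, g s)) ` S)" by simp
qed

text \<open>Each minimum is at most the value at the other minimiser, so only the pointwise distance
  of \<open>F\<close> and \<open>G\<close> enters, not the distance of \<open>a\<close> and
  \<open>b\<close>.\<close>

lemma argmin_value_diff_le:
  fixes F G :: "'a \<Rightarrow> real"
  assumes "is_arg_min F P a" "is_arg_min G P b" "\<And>y. P y \<Longrightarrow> \<bar>F y - G y\<bar> \<le> d"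
  shows "\<bar>F a - G b\<bar> \<le> d"
proof -
  have "F a \<le> F b" "G b \<le> G a" "P a" "P b" using assms by (auto simp: is_arg_min_linorder)
  with assms(3)[of a] assms(3)[of b] show ?thesis by linarith
qed

section \<open>Lebesgue measure of sets with short slices, and bounded densities\<close>

lemma emeasure_lborel_le_diameter:
  fixes S :: "real set"
  assumes "\<And>s t. s \<in> S \<Longrightarrow> t \<in> S \<Longrightarrow> \<bar>s - t\<bar> \<le> d"
  shows "emeasure lborel S \<le> ennreal d"
proof (cases "S = {}")
  case False
  then obtain s0 where s0: "s0 \<in> S" by auto
  have bdd: "bdd_below S"
    using assms[OF s0] by (intro bdd_belowI[of _ "s0 - d"]) (force simp: abs_le_iff)
  have d: "0 \<le> d" using assms[OF s0 s0] by simp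
  have "S \<subseteq> {Inf S..Inf S + d}"
  proof
    fix t assume t: "t \<in> S"
    have "t - d \<le> Inf S"
      using assms t by (intro cInf_greatest[OF False]) (force simp: abs_le_iff)
    with cInf_lower[OF t bdd] show "t \<in> {Inf S..Inf S + d}" by auto
  qed
  hence "emeasure lborel S \<le> emeasure lborel {Inf S..Inf S + d}"
    by (intro emeasure_mono) auto
  also have "\<dots> = ennreal d" using d by simp
  finally show ?thesis .
qed simp

text \<open>By Tonelli the measure is the integral of the slice lengths in the third coordinate.
  These are at most \<open>d\<close> over the base rectangle, and slices outside it are
  empty.\<close>

lemma emeasure_lborel_le_slices:
  fixes A :: "(real \<times> real \<times> real) set"
  assumes A: "A \<in> sets borel" and sub: "A \<subseteq> {a..b} \<times> {a'..b'} \<times> UNIV"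
    and "a \<le> b" "a' \<le> b'" "0 \<le> d"
    and slice: "\<And>u v s t. (u, v, s) \<in> A \<Longrightarrow> (u, v, t) \<in> A \<Longrightarrow> \<bar>s - t\<bar> \<le> d"
  shows "emeasure lborel A \<le> ennreal ((b - a) * (b' - a') * d)"
proof -
  have [measurable]: "A \<in> sets (lborel \<Otimes>\<^sub>M lborel \<Otimes>\<^sub>M lborel)"
    using A by (metis lborel_prod sets_lborel)
  have "emeasure lborel A = emeasure (lborel \<Otimes>\<^sub>M lborel \<Otimes>\<^sub>M lborel) A"
    by (simp add: lborel_prod)
  also have "\<dots> = (\<integral>\<^sup>+u. emeasure (lborel \<Otimes>\<^sub>M lborel) (Pair u -` A) \<partial>lborel)"
  proof (rule sigma_finite_measure.emeasure_pair_measure_alt)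
    show "sigma_finite_measure (lborel \<Otimes>\<^sub>M lborel :: (real \<times> real) measure)"
      unfolding lborel_prod by (rule sigma_finite_lborel)
  qed measurable
  also have "\<dots> = (\<integral>\<^sup>+u. \<integral>\<^sup>+v. emeasure lborel (Pair v -` Pair u -` A) \<partial>lborel \<partial>lborel)"
    by (intro nn_integral_cong sigma_finite_measure.emeasure_pair_measure_alt
        sigma_finite_lborel sets_Pair1[of A lborel]) measurable
  also have "\<dots> \<le> (\<integral>\<^sup>+u. \<integral>\<^sup>+v. (ennreal d * indicator {a'..b'} v) * indicator {a..b} u \<partial>lborel \<partial>lborel)"
  proof (intro nn_integral_mono)
    fix u v
    show "emeasure lborel (Pair v -` Pair u -` A)
        \<le> ennreal d * indicator {a'..b'} v * indicator {a..b} u"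
    proof (cases "u \<in> {a..b} \<and> v \<in> {a'..b'}")
      case True
      have "emeasure lborel (Pair v -` Pair u -` A) \<le> ennreal d"
        by (intro emeasure_lborel_le_diameter) (auto intro: slice)
      with True show ?thesis by simp
    next
      case False
      hence "Pair v -` Pair u -` A = {}" using sub by auto
      thus ?thesis by simp
    qed
  qed
  also have "\<dots> = ennreal d * ennreal (b' - a') * ennreal (b - a)"
    using assms by (simp add: nn_integral_multc nn_integral_cmult)
  also have "\<dots> = ennreal ((b - a) * (b' - a') * d)"
    using assms by (simp add: ennreal_mult[symmetric] mult_ac)
  finally show ?thesis .
qed

text \<open>Since \<open>ennreal\<close> truncates negative values to 0, the essential bound on the
  absolute value enters only through \<open>f y \<le> C\<close> almost everywhere.\<close>

lemma emeasure_density_le_esssup: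
  assumes f: "f \<in> borel_measurable M" and bound: "esssup M (\<lambda>y. ereal \<bar>f y\<bar>) \<le> ereal C"
    and A: "A \<in> sets M"
  shows "emeasure (density M (\<lambda>y. ennreal (f y))) A \<le> ennreal C * emeasure M A"
proof -
  have "AE y in M. ereal \<bar>f y\<bar> \<le> esssup M (\<lambda>y. ereal \<bar>f y\<bar>)" by (rule esssup_AE)
  hence "AE y in M. f y \<le> C"
  proof eventually_elim
    case (elim y)
    hence "ereal \<bar>f y\<bar> \<le> ereal C" using bound by (rule order_trans)
    thus ?case by simp
  qed
  hence "AE y in M. ennreal (f y) * indicator A y \<le> ennreal C * indicator A y"
    by eventually_elim (auto intro: mult_right_mono ennreal_leI)
  hence "(\<integral>\<^sup>+y. ennreal (f y) * indicator A y \<partial>M) \<le> (\<integral>\<^sup>+y. ennreal C * indicator A y \<partial>M)"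
    by (rule nn_integral_mono_AE)
  thus ?thesis using f A by (simp add: emeasure_density nn_integral_cmult_indicator)
qed

section \<open>Best responses of a single type\<close>

text \<open>Staying out is the contract whose price, \<alpha> and \<beta> are all 0. Facts about
  best responses are therefore proved once for a general contract and then specialised to both
  options.\<close>

lemma CE_out_eq_CE_in: "CE_out \<mu> lam x = CE_in \<mu> lam x 0 0 0"
  by (simp add: fun_eq_iff CE_out_def CE_in_def)

lemma E_out_eq_E_in: "E_out \<mu> lam x Emax = E_in \<mu> lam x Emax 0 0 0"
  by (simp add: fun_eq_iff E_out_def E_in_def CE_out_eq_CE_in)

lemma e_out_eq_e_in: "e_out \<mu> lam x Emax = e_in \<mu> lam x Emax 0 0 0"
  by (simp add: fun_eq_iff e_out_def e_in_def E_out_eq_E_in)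

locale convex_effort_costs =
  fixes \<mu> lam :: "real \<Rightarrow> real" and x Emax L_mu L_lam :: real
  assumes x_nonneg: "0 \<le> x"
    and Emax_nonneg: "0 \<le> Emax"
    and mu_cont: "continuous_on {0..(1 + x) * Emax} \<mu>"
    and lam_cont: "continuous_on {0..(1 + x) * Emax} lam"
    and mu_convex: "strictly_convex_on {0..(1 + x) * Emax} \<mu>"
    and lam_convex: "strictly_convex_on {0..(1 + x) * Emax} lam"
    and mu_lipschitz: "\<And>z1 z2. z1 \<in> {0..(1 + x) * Emax} \<Longrightarrow> z2 \<in> {0..(1 + x) * Emax} \<Longrightarrow>
      \<bar>\<mu> z1 - \<mu> z2\<bar> \<le> L_mu * \<bar>z1 - z2\<bar>"
    and lam_lipschitz: "\<And>z1 z2. z1 \<in> {0..(1 + x) * Emax} \<Longrightarrow> z2 \<in> {0..(1 + x) * Emax} \<Longrightarrow>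
      \<bar>lam z1 - lam z2\<bar> \<le> L_lam * \<bar>z1 - z2\<bar>"
begin

abbreviation "cost \<equiv> CE_in \<mu> lam x"
abbreviation "best_effort \<equiv> e_in \<mu> lam x Emax"
abbreviation "best_efforts \<equiv> E_in \<mu> lam x Emax"

lemma effort_translate_mem:
  assumes "e \<in> {0..Emax}" "m \<in> {0..Emax}"
  shows "e + x * m \<in> {0..(1 + x) * Emax}"
proof -
  have "x * m \<le> x * Emax" using assms x_nonneg by (intro mult_left_mono) auto
  thus ?thesis using assms x_nonneg by (auto simp: algebra_simps)
qed

text \<open>In the variable \<open>z = e + x * m\<close> the cost is a function \<open>h\<close>
  that does not involve \<open>m\<close>, plus a term constant in \<open>e\<close>; \<open>h\<close>
  is strictly convex because \<open>1 - \<beta>\<close> and \<gamma> are positive. Arbitrary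
  minimisers are compared, so that \<open>m = m'\<close> yields uniqueness.\<close>

lemma best_efforts_diff_le:
  assumes "\<beta> < 1" "0 < fst \<theta>" "m \<in> {0..Emax}" "m' \<in> {0..Emax}"
    and "e \<in> best_efforts p \<alpha> \<beta> \<theta> m" "e' \<in> best_efforts p \<alpha> \<beta> \<theta> m'"
  shows "\<bar>e - e'\<bar> \<le> x * \<bar>m - m'\<bar>"
proof -
  obtain \<gamma> c \<sigma> where \<theta>: "\<theta> = (\<gamma>, c, \<sigma>)" by (cases \<theta>)
  define h where "h z = (p + 1/2 * \<gamma> * \<alpha>\<^sup>2 * \<sigma>\<^sup>2) + (c - \<alpha>) * z + (1 - \<beta>) * \<mu> z
    + (1/2 * \<gamma> * (1 - \<beta>)\<^sup>2) * lam z" for z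
  have "strictly_convex_on {0..(1 + x) * Emax} h"
    unfolding h_def
    by (intro strictly_convex_on_affine_combination mu_convex lam_convex) (use assms \<theta> in auto)
  moreover have cost: "cost p \<alpha> \<beta> \<theta> k = (\<lambda>e. h (e + x * k) - (c - \<alpha>) * (x * k))" for k
    by (simp add: \<theta> h_def CE_in_def fun_eq_iff algebra_simps)
  moreover have "is_arg_min (\<lambda>e. h (e + x * m)) (\<lambda>e. e \<in> {0..Emax}) e"
    "is_arg_min (\<lambda>e. h (e + x * m')) (\<lambda>e. e \<in> {0..Emax}) e'"
    using assms by (auto simp: E_in_def cost is_arg_min_def)
  ultimately have "\<bar>e - e'\<bar> \<le> \<bar>x * m - x * m'\<bar>"
    using assms effort_translate_mem[of Emax m] effort_translate_mem[of Emax m']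
      effort_translate_mem[of 0 m] effort_translate_mem[of 0 m'] Emax_nonneg
    by (intro argmin_translate_lipschitz[of "(1 + x) * Emax" h]) auto
  also have "\<dots> = x * \<bar>m - m'\<bar>"
    using x_nonneg by (simp add: abs_mult right_diff_distrib[symmetric])
  finally show ?thesis .
qed

lemma continuous_on_cost:
  assumes "m \<in> {0..Emax}"
  shows "continuous_on (S \<times> {0..Emax}) (\<lambda>z. cost p \<alpha> \<beta> (fst z) m (snd z))"
proof -
  have "continuous_on (S \<times> {0..Emax}) (\<lambda>z. g (snd z + x * m))"
    if "continuous_on {0..(1 + x) * Emax} g" for g :: "real \<Rightarrow> real" and S :: "agent set"
    using that assms effort_translate_mem
    by (intro continuous_on_compose2[OF that] continuous_intros) auto
  from this[OF mu_cont] this[OF lam_cont] show ?thesis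
    unfolding CE_in_def split_beta by (intro continuous_intros) auto
qed

lemma best_efforts_nonempty:
  assumes "m \<in> {0..Emax}"
  shows "best_efforts p \<alpha> \<beta> \<theta> m \<noteq> {}"
proof -
  have "continuous_on {0..Emax} ((\<lambda>z. cost p \<alpha> \<beta> (fst z) m (snd z)) \<circ> Pair \<theta>)"
    by (intro continuous_on_compose continuous_intros
        continuous_on_subset[OF continuous_on_cost[OF assms, of "{\<theta>}"]]) auto
  hence "continuous_on {0..Emax} (cost p \<alpha> \<beta> \<theta> m)" by (simp add: o_def)
  from continuous_attains_inf[OF _ _ this] Emax_nonneg show ?thesis
    by (force simp: E_in_def is_arg_min_linorder)
qed

lemma best_efforts_eq:
  assumes "\<beta> < 1" "0 < fst \<theta>" "m \<in> {0..Emax}"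
  shows "best_efforts p \<alpha> \<beta> \<theta> m = {best_effort p \<alpha> \<beta> \<theta> m}"
proof -
  obtain e where e: "e \<in> best_efforts p \<alpha> \<beta> \<theta> m" using best_efforts_nonempty assms by blast
  moreover have "e' = e" if "e' \<in> best_efforts p \<alpha> \<beta> \<theta> m" for e'
    using best_efforts_diff_le[OF assms(1-3) assms(3) that e] by simp
  ultimately have "best_efforts p \<alpha> \<beta> \<theta> m = {e}" by blast
  thus ?thesis by (simp add: e_in_def)
qed

lemma best_effort_argmin:
  assumes "\<beta> < 1" "0 < fst \<theta>" "m \<in> {0..Emax}"
  shows "is_arg_min (cost p \<alpha> \<beta> \<theta> m) (\<lambda>e. e \<in> {0..Emax}) (best_effort p \<alpha> \<beta> \<theta> m)"
  using best_efforts_eq[OF assms, of p \<alpha>] by (auto simp: E_in_def)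

lemma best_effort_mem:
  assumes "\<beta> < 1" "0 < fst \<theta>" "m \<in> {0..Emax}"
  shows "best_effort p \<alpha> \<beta> \<theta> m \<in> {0..Emax}"
  using best_effort_argmin[OF assms] unfolding is_arg_min_def by blast

lemma best_effort_lipschitz:
  assumes "\<beta> < 1" "0 < fst \<theta>" "m \<in> {0..Emax}" "m' \<in> {0..Emax}"
  shows "\<bar>best_effort p \<alpha> \<beta> \<theta> m - best_effort p \<alpha> \<beta> \<theta> m'\<bar> \<le> x * \<bar>m - m'\<bar>"
  using best_efforts_diff_le[OF assms] best_efforts_eq assms by blast

text \<open>Continuity in the type is what later makes the optimal efforts measurable with respect
  to the type distribution.\<close>

lemma continuous_on_best_effort:
  assumes "\<beta> < 1" "m \<in> {0..Emax}" "closed S" "\<And>\<theta>. \<theta> \<in> S \<Longrightarrow> 0 < fst \<theta>"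
  shows "continuous_on S (\<lambda>\<theta>. best_effort p \<alpha> \<beta> \<theta> m)"
proof (rule continuous_on_unique_argmin[OF \<open>closed S\<close> compact_Icc continuous_on_cost])
  fix \<theta> e assume "\<theta> \<in> S" "is_arg_min (cost p \<alpha> \<beta> \<theta> m) (\<lambda>k. k \<in> {0..Emax}) e"
  thus "e = best_effort p \<alpha> \<beta> \<theta> m"
    using best_efforts_eq[of \<beta> \<theta> m p \<alpha>] assms by (auto simp: E_in_def)
qed (use assms best_effort_argmin in auto)

abbreviation "best_cost p \<alpha> \<beta> \<theta> m \<equiv> cost p \<alpha> \<beta> \<theta> m (best_effort p \<alpha> \<beta> \<theta> m)"

lemma continuous_on_best_cost:
  assumes "\<beta> < 1" "m \<in> {0..Emax}" "closed S" "\<And>\<theta>. \<theta> \<in> S \<Longrightarrow> 0 < fst \<theta>"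
  shows "continuous_on S (\<lambda>\<theta>. best_cost p \<alpha> \<beta> \<theta> m)"
proof -
  have "continuous_on S ((\<lambda>z. cost p \<alpha> \<beta> (fst z) m (snd z)) \<circ> (\<lambda>\<theta>. (\<theta>, best_effort p \<alpha> \<beta> \<theta> m)))"
    using best_effort_mem assms
    by (intro continuous_on_compose continuous_intros continuous_on_best_effort
        continuous_on_subset[OF continuous_on_cost[of m S]]) auto
  thus ?thesis by (simp add: o_def)
qed

text \<open>At a fixed effort, \<open>m\<close> enters the cost only through \<mu> and
  \<open>lam\<close>; their Lipschitz bounds carry over to the minimum by
  \<open>argmin_value_diff_le\<close>.\<close>

lemma best_cost_lipschitz:
  assumes "\<beta> < 1" "0 < fst \<theta>" "m \<in> {0..Emax}" "m' \<in> {0..Emax}"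
  shows "\<bar>best_cost p \<alpha> \<beta> \<theta> m - best_cost p \<alpha> \<beta> \<theta> m'\<bar>
    \<le> ((1 - \<beta>) * L_mu + 1/2 * fst \<theta> * (1 - \<beta>)\<^sup>2 * L_lam) * (x * \<bar>m - m'\<bar>)"
proof (rule argmin_value_diff_le[OF best_effort_argmin best_effort_argmin])
  fix e assume e: "e \<in> {0..Emax}"
  obtain \<gamma> c \<sigma> where \<theta>: "\<theta> = (\<gamma>, c, \<sigma>)" by (cases \<theta>)
  let ?z = "e + x * m" and ?z' = "e + x * m'"
  have dist: "\<bar>?z - ?z'\<bar> = x * \<bar>m - m'\<bar>"
    using x_nonneg by (simp add: abs_mult right_diff_distrib[symmetric])
  have "cost p \<alpha> \<beta> \<theta> m e - cost p \<alpha> \<beta> \<theta> m' e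
      = (1 - \<beta>) * (\<mu> ?z - \<mu> ?z') + (1/2 * \<gamma> * (1 - \<beta>)\<^sup>2) * (lam ?z - lam ?z')"
    by (simp add: \<theta> CE_in_def field_simps)
  also have "\<bar>\<dots>\<bar> \<le> (1 - \<beta>) * \<bar>\<mu> ?z - \<mu> ?z'\<bar> + (1/2 * \<gamma> * (1 - \<beta>)\<^sup>2) * \<bar>lam ?z - lam ?z'\<bar>"
    using assms \<theta> by (intro order_trans[OF abs_triangle_ineq]) (simp add: abs_mult)
  also have "\<dots> \<le> (1 - \<beta>) * (L_mu * \<bar>?z - ?z'\<bar>) + (1/2 * \<gamma> * (1 - \<beta>)\<^sup>2) * (L_lam * \<bar>?z - ?z'\<bar>)"
    using assms \<theta> e
    by (intro add_mono mult_left_mono mu_lipschitz lam_lipschitz effort_translate_mem) auto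
  finally show "\<bar>cost p \<alpha> \<beta> \<theta> m e - cost p \<alpha> \<beta> \<theta> m' e\<bar>
      \<le> ((1 - \<beta>) * L_mu + 1/2 * fst \<theta> * (1 - \<beta>)\<^sup>2 * L_lam) * (x * \<bar>m - m'\<bar>)"
    unfolding dist by (simp add: \<theta> algebra_simps)
qed (use assms in auto)

text \<open>The parameter \<sigma> enters the cost through a term constant in \<open>e\<close>, so
  it has no influence on the minimiser. The value 0 is a reference point that makes this term
  explicit.\<close>

lemma best_cost_sigma:
  "best_cost p \<alpha> \<beta> (\<gamma>, c, \<sigma>) m = best_cost p \<alpha> \<beta> (\<gamma>, c, 0) m + 1/2 * \<gamma> * \<alpha>\<^sup>2 * \<sigma>\<^sup>2"
proof -
  have cost: "cost p \<alpha> \<beta> (\<gamma>, c, \<sigma>) m = (\<lambda>e. cost p \<alpha> \<beta> (\<gamma>, c, 0) m e + 1/2 * \<gamma> * \<alpha>\<^sup>2 * \<sigma>\<^sup>2)"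
    by (simp add: CE_in_def fun_eq_iff)
  hence "best_effort p \<alpha> \<beta> (\<gamma>, c, \<sigma>) m = best_effort p \<alpha> \<beta> (\<gamma>, c, 0) m"
    by (simp add: e_in_def E_in_def is_arg_min_def)
  thus ?thesis using cost by simp
qed

end

section \<open>The game: one contract and a type distribution with bounded density\<close>

locale insurance_game = convex_effort_costs +
  fixes p \<alpha> \<beta> C_f c_sigma C_m C_q \<gamma>_min \<gamma>_max c_max \<sigma>_min \<sigma>_max :: real
    and \<Theta> :: "agent set" and \<pi> :: "agent measure" and f :: "agent \<Rightarrow> real"
  assumes L_nonneg: "0 \<le> L_mu" "0 \<le> L_lam"
    and params: "0 < \<gamma>_min" "\<gamma>_min < \<gamma>_max" "0 < c_max" "0 < \<sigma>_min" "\<sigma>_min < \<sigma>_max"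
    and Theta: "\<Theta> = {\<gamma>_min..\<gamma>_max} \<times> {0..c_max} \<times> {\<sigma>_min..\<sigma>_max}"
    and contract: "0 < \<alpha>" "0 \<le> \<beta>" "\<beta> < 1"
    and prob: "prob_space \<pi>"
    and f_meas: "f \<in> borel_measurable (restrict_space lborel \<Theta>)"
    and pi_density: "\<pi> = density (restrict_space lborel \<Theta>) (\<lambda>\<theta>. ennreal (f \<theta>))"
    and f_bound: "esssup (restrict_space lborel \<Theta>) (\<lambda>\<theta>. ereal \<bar>f \<theta>\<bar>) \<le> ereal C_f"
    and c_sigma: "c_sigma = \<gamma>_min * \<alpha>\<^sup>2 * \<sigma>_min"
    and C_m: "C_m = x * (2 * c_max + \<alpha> + (2 - \<beta>) * L_mu
                          + 1/2 * \<gamma>_max * ((1 - \<beta>)\<^sup>2 + 1) * L_lam)"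
    and C_q: "C_q = C_f / c_sigma * (\<gamma>_max - \<gamma>_min) * c_max * C_m"
begin

sublocale pi: prob_space \<pi> by (rule prob)

abbreviation "ein \<equiv> e_in \<mu> lam x Emax p \<alpha> \<beta>"
abbreviation "eout \<equiv> e_out \<mu> lam x Emax"

lemma fst_pos: "\<theta> \<in> \<Theta> \<Longrightarrow> 0 < fst \<theta>"
  using params by (auto simp: Theta)

lemma closed_Theta: "closed \<Theta>"
  by (simp add: Theta closed_Times)

lemma Theta_borel [measurable]: "\<Theta> \<in> sets borel"
  using closed_Theta by simp

lemma space_pi: "space \<pi> = \<Theta>"
  by (simp add: pi_density space_restrict_space)

lemma sets_pi: "sets \<pi> = sets (restrict_space borel \<Theta>)"
  by (simp add: pi_density sets_restrict_space)

lemma measurable_pi_continuous: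
  assumes "continuous_on \<Theta> (g :: agent \<Rightarrow> real)"
  shows "g \<in> borel_measurable \<pi>"
  using borel_measurable_continuous_on_restrict[OF assms] measurable_cong_sets[OF sets_pi refl]
  by blast

lemma emeasure_pi_le:
  assumes "A \<in> sets \<pi>"
  shows "emeasure \<pi> A \<le> ennreal C_f * emeasure lborel A"
proof -
  have A: "A \<in> sets (restrict_space lborel \<Theta>)" using assms by (simp add: pi_density)
  hence "A \<subseteq> \<Theta>" using sets.sets_into_space[of A] by (force simp: space_restrict_space)
  hence "emeasure (restrict_space lborel \<Theta>) A = emeasure lborel A"
    by (intro emeasure_restrict_space) simp_all
  thus ?thesis
    using emeasure_density_le_esssup[OF f_meas f_bound A] by (simp add: pi_density)
qed

text \<open>A negative \<open>C_f\<close> would become 0 under \<open>ennreal\<close> and leave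
  \<pi> with total mass 0.\<close>

lemma C_f_nonneg: "0 \<le> C_f"
proof (rule ccontr)
  assume "\<not> 0 \<le> C_f"
  hence "ennreal C_f = 0" by (simp add: ennreal_neg)
  with emeasure_pi_le[OF sets.top] pi.emeasure_space_1 show False by simp
qed

lemma c_sigma_pos: "0 < c_sigma"
  using params contract by (simp add: c_sigma)

lemma C_m_nonneg: "0 \<le> C_m"
  using params contract L_nonneg x_nonneg by (simp add: C_m)

lemma C_q_nonneg: "0 \<le> C_q"
  using C_f_nonneg c_sigma_pos C_m_nonneg params by (simp add: C_q)

lemma ein_mem: "\<theta> \<in> \<Theta> \<Longrightarrow> m \<in> {0..Emax} \<Longrightarrow> ein \<theta> m \<in> {0..Emax}"
  using best_effort_mem contract fst_pos by blast

lemma eout_mem: "\<theta> \<in> \<Theta> \<Longrightarrow> m \<in> {0..Emax} \<Longrightarrow> eout \<theta> m \<in> {0..Emax}"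
  using best_effort_mem[of 0] fst_pos by (simp add: e_out_eq_e_in)

lemma E_in_eq: "\<theta> \<in> \<Theta> \<Longrightarrow> m \<in> {0..Emax} \<Longrightarrow> E_in \<mu> lam x Emax p \<alpha> \<beta> \<theta> m = {ein \<theta> m}"
  using best_efforts_eq contract fst_pos by blast

lemma E_out_eq: "\<theta> \<in> \<Theta> \<Longrightarrow> m \<in> {0..Emax} \<Longrightarrow> E_out \<mu> lam x Emax \<theta> m = {eout \<theta> m}"
  using best_efforts_eq[of 0] fst_pos by (simp add: E_out_eq_E_in e_out_eq_e_in)

lemma ein_lipschitz:
  "\<theta> \<in> \<Theta> \<Longrightarrow> m \<in> {0..Emax} \<Longrightarrow> m' \<in> {0..Emax} \<Longrightarrow> \<bar>ein \<theta> m - ein \<theta> m'\<bar> \<le> x * \<bar>m - m'\<bar>"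
  using best_effort_lipschitz contract fst_pos by blast

lemma eout_lipschitz:
  "\<theta> \<in> \<Theta> \<Longrightarrow> m \<in> {0..Emax} \<Longrightarrow> m' \<in> {0..Emax} \<Longrightarrow> \<bar>eout \<theta> m - eout \<theta> m'\<bar> \<le> x * \<bar>m - m'\<bar>"
  using best_effort_lipschitz[of 0] fst_pos by (simp add: e_out_eq_e_in)

lemma measurable_ein: "m \<in> {0..Emax} \<Longrightarrow> (\<lambda>\<theta>. ein \<theta> m) \<in> borel_measurable \<pi>"
  using contract fst_pos closed_Theta
  by (intro measurable_pi_continuous continuous_on_best_effort) auto

lemma measurable_eout: "m \<in> {0..Emax} \<Longrightarrow> (\<lambda>\<theta>. eout \<theta> m) \<in> borel_measurable \<pi>"
  unfolding e_out_eq_e_in using fst_pos closed_Theta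
  by (intro measurable_pi_continuous continuous_on_best_effort) auto

section \<open>The cost gap and the types that may switch\<close>

text \<open>Negative values favour participation; the subtracted term is the outside option, encoded
  as the contract \<open>0 0 0\<close>.\<close>

definition gap :: "agent \<Rightarrow> real \<Rightarrow> real" where
  "gap \<theta> m = best_cost p \<alpha> \<beta> \<theta> m - best_cost 0 0 0 \<theta> m"

lemma measurable_gap: "m \<in> {0..Emax} \<Longrightarrow> (\<lambda>\<theta>. gap \<theta> m) \<in> borel_measurable \<pi>"
  unfolding gap_def using contract fst_pos closed_Theta
  by (intro measurable_pi_continuous continuous_on_diff continuous_on_best_cost) auto

text \<open>The Lipschitz constants of the two optimal costs add up, the outside option contributing
  the case \<beta> = 0.\<close>

lemma gap_lipschitz:
  assumes "\<theta> \<in> \<Theta>" "m \<in> {0..Emax}" "m' \<in> {0..Emax}"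
  shows "\<bar>gap \<theta> m - gap \<theta> m'\<bar> \<le> C_m * \<bar>m - m'\<bar>"
proof -
  let ?\<gamma> = "fst \<theta>" and ?d = "x * \<bar>m - m'\<bar>"
  have \<gamma>: "0 < ?\<gamma>" "?\<gamma> \<le> \<gamma>_max" using assms fst_pos by (auto simp: Theta)
  have "\<bar>gap \<theta> m - gap \<theta> m'\<bar>
      \<le> ((1 - \<beta>) * L_mu + 1/2 * ?\<gamma> * (1 - \<beta>)\<^sup>2 * L_lam) * ?d
        + ((1 - 0) * L_mu + 1/2 * ?\<gamma> * (1 - 0)\<^sup>2 * L_lam) * ?d"
    using best_cost_lipschitz[of \<beta> \<theta> m m' p \<alpha>] best_cost_lipschitz[of 0 \<theta> m m' 0 0] assms contract \<gamma>
    unfolding gap_def by linarith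
  also have "\<dots> = ((2 - \<beta>) * L_mu + ?\<gamma> * (1/2 * ((1 - \<beta>)\<^sup>2 + 1) * L_lam)) * ?d"
    by (simp add: field_simps)
  \<comment> \<open>Here \<gamma> is replaced by its upper bound and the nonnegative
    \<open>2 * c_max + \<alpha>\<close> is added, to reach \<open>C_m\<close>.\<close>
  also have "\<dots> \<le> (2 * c_max + \<alpha> + (2 - \<beta>) * L_mu + \<gamma>_max * (1/2 * ((1 - \<beta>)\<^sup>2 + 1) * L_lam)) * ?d"
    using \<gamma> L_nonneg x_nonneg params contract
    by (intro mult_right_mono add_mono) (auto intro!: mult_right_mono)
  also have "\<dots> = C_m * \<bar>m - m'\<bar>" by (simp add: C_m)
  finally show ?thesis .
qed

text \<open>The \<sigma>-term of the outside option vanishes, its \<alpha> being 0. Hence \<sigma>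
  shifts the gap by an amount that is the same for every \<open>m\<close>.\<close>

lemma gap_sigma:
  "gap (\<gamma>, c, \<sigma>) m = gap (\<gamma>, c, 0) m + 1/2 * \<gamma> * \<alpha>\<^sup>2 * \<sigma>\<^sup>2"
  using best_cost_sigma[of p \<alpha> \<beta> \<gamma> c \<sigma> m] best_cost_sigma[of 0 0 0 \<gamma> c \<sigma> m]
  by (simp add: gap_def)

text \<open>The difference of squares factors, and the resulting slope
  \<open>\<gamma> * \<alpha>\<^sup>2 * ((\<sigma> + \<sigma>') / 2)\<close> is smallest at the lower
  ends of the parameter ranges, where it equals \<open>c_sigma\<close>.\<close>

lemma gap_sigma_expansive:
  assumes "(\<gamma>, c, \<sigma>) \<in> \<Theta>" "(\<gamma>, c, \<sigma>') \<in> \<Theta>"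
  shows "c_sigma * \<bar>\<sigma> - \<sigma>'\<bar> \<le> \<bar>gap (\<gamma>, c, \<sigma>) m - gap (\<gamma>, c, \<sigma>') m\<bar>"
proof -
  have b: "\<gamma>_min \<le> \<gamma>" "\<sigma>_min \<le> \<sigma>" "\<sigma>_min \<le> \<sigma>'" using assms by (auto simp: Theta)
  have "c_sigma \<le> \<gamma> * \<alpha>\<^sup>2 * ((\<sigma> + \<sigma>') / 2)"
    unfolding c_sigma using b params by (intro mult_mono) auto
  hence "c_sigma * \<bar>\<sigma> - \<sigma>'\<bar> \<le> \<gamma> * \<alpha>\<^sup>2 * ((\<sigma> + \<sigma>') / 2) * \<bar>\<sigma> - \<sigma>'\<bar>"
    by (intro mult_right_mono) auto
  also have "\<dots> = \<bar>\<gamma> * \<alpha>\<^sup>2 * ((\<sigma> + \<sigma>') / 2) * (\<sigma> - \<sigma>')\<bar>"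
    using b params by (simp add: abs_mult)
  also have "\<gamma> * \<alpha>\<^sup>2 * ((\<sigma> + \<sigma>') / 2) * (\<sigma> - \<sigma>') = gap (\<gamma>, c, \<sigma>) m - gap (\<gamma>, c, \<sigma>') m"
    unfolding gap_sigma[of \<gamma> c \<sigma>] gap_sigma[of \<gamma> c \<sigma>'] by (simp add: field_simps power2_eq_square)
  finally show ?thesis .
qed

text \<open>The weak inequalities keep indifferent types inside: \<open>switching m m\<close> is
  exactly the set of types with zero gap at \<open>m\<close>.\<close>

definition switching :: "real \<Rightarrow> real \<Rightarrow> agent set" where
  "switching m m' = {\<theta> \<in> \<Theta>. gap \<theta> m \<le> 0 \<and> 0 \<le> gap \<theta> m' \<or> gap \<theta> m' \<le> 0 \<and> 0 \<le> gap \<theta> m}"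

lemma sets_switching:
  assumes "m \<in> {0..Emax}" "m' \<in> {0..Emax}"
  shows "switching m m' \<in> sets \<pi>"
proof -
  note [measurable] = measurable_gap[OF assms(1)] measurable_gap[OF assms(2)]
  have "{\<theta> \<in> space \<pi>. gap \<theta> m \<le> 0 \<and> 0 \<le> gap \<theta> m' \<or> gap \<theta> m' \<le> 0 \<and> 0 \<le> gap \<theta> m} \<in> sets \<pi>"
    by measurable
  thus ?thesis unfolding switching_def space_pi .
qed

text \<open>The difference of the gaps at \<open>m\<close> and \<open>m'\<close> does not depend on \<open>\<sigma>\<close>, so on a slice
  all gaps at \<open>m\<close> lie in one interval of length \<open>C_m * \<bar>m - m'\<bar>\<close>.\<close>

lemma switching_slice:
  assumes "m \<in> {0..Emax}" "m' \<in> {0..Emax}"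
    and "(\<gamma>, c, \<sigma>) \<in> switching m m'" "(\<gamma>, c, \<sigma>') \<in> switching m m'"
  shows "\<bar>\<sigma> - \<sigma>'\<bar> \<le> C_m * \<bar>m - m'\<bar> / c_sigma"
proof -
  let ?g = "\<lambda>\<sigma>. gap (\<gamma>, c, \<sigma>)"
  have \<Theta>: "(\<gamma>, c, \<sigma>) \<in> \<Theta>" "(\<gamma>, c, \<sigma>') \<in> \<Theta>" using assms by (auto simp: switching_def)
  have "?g \<sigma> m' - ?g \<sigma> m = ?g \<sigma>' m' - ?g \<sigma>' m"
    unfolding gap_sigma[of \<gamma> c \<sigma>] gap_sigma[of \<gamma> c \<sigma>'] by simp
  \<comment> \<open>If \<open>D\<close> is the common difference of the gaps at \<open>m'\<close>
    and \<open>m\<close>, both gaps at \<open>m\<close> lie between 0 and \<open>-D\<close>.\<close>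
  hence "\<bar>?g \<sigma> m - ?g \<sigma>' m\<bar> \<le> \<bar>?g \<sigma> m - ?g \<sigma> m'\<bar>"
    using assms(3,4) unfolding switching_def mem_Collect_eq by argo
  also have "\<dots> \<le> C_m * \<bar>m - m'\<bar>" using gap_lipschitz[OF \<Theta>(1) assms(1,2)] .
  finally have "c_sigma * \<bar>\<sigma> - \<sigma>'\<bar> \<le> C_m * \<bar>m - m'\<bar>"
    using gap_sigma_expansive[OF \<Theta>] by (rule order_trans[rotated])
  thus ?thesis using c_sigma_pos by (simp add: pos_le_divide_eq mult.commute)
qed

text \<open>The area of the rectangle of pairs (\<gamma>, c), times the slice length from
  \<open>switching_slice\<close>, times the density bound \<open>C_f\<close>, is the right-hand side
  by the definition of \<open>C_q\<close>.\<close>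

lemma measure_switching:
  assumes "m \<in> {0..Emax}" "m' \<in> {0..Emax}"
  shows "measure \<pi> (switching m m') \<le> C_q * \<bar>m - m'\<bar>"
proof -
  let ?d = "C_m * \<bar>m - m'\<bar> / c_sigma" and ?A = "switching m m'"
  have d: "0 \<le> ?d" using C_m_nonneg c_sigma_pos by simp
  have "?A \<in> sets borel"
    using sets_switching[OF assms] Theta_borel by (simp add: sets_pi sets_restrict_space_iff)
  moreover have "?A \<subseteq> \<Theta>" "\<Theta> \<subseteq> {\<gamma>_min..\<gamma>_max} \<times> {0..c_max} \<times> UNIV"
    by (auto simp: switching_def) (auto simp: Theta)
  ultimately have "emeasure lborel ?A \<le> ennreal ((\<gamma>_max - \<gamma>_min) * (c_max - 0) * ?d)"
    using params d switching_slice[OF assms]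
    by (intro emeasure_lborel_le_slices) (auto intro: order_trans)
  hence "ennreal C_f * emeasure lborel ?A \<le> ennreal C_f * ennreal ((\<gamma>_max - \<gamma>_min) * (c_max - 0) * ?d)"
    by (intro mult_left_mono) auto
  also have "\<dots> = ennreal (C_q * \<bar>m - m'\<bar>)"
    using C_f_nonneg params mult_nonneg_nonneg[OF _ d, of "(\<gamma>_max - \<gamma>_min) * (c_max - 0)"]
    by (subst ennreal_mult[symmetric]) (simp_all add: C_q mult_ac)
  finally have "emeasure \<pi> ?A \<le> ennreal (C_q * \<bar>m - m'\<bar>)"
    using emeasure_pi_le[OF sets_switching[OF assms]] by (rule order_trans[rotated])
  thus ?thesis using C_q_nonneg by (simp add: pi.emeasure_eq_measure)
qed

section \<open>Participation rules and aggregate effort\<close>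

abbreviation "rule_at m \<equiv>
  participation_rule \<mu> lam x p \<alpha> \<beta> \<pi> m (\<lambda>\<theta>. ein \<theta> m) (\<lambda>\<theta>. eout \<theta> m)"

text \<open>Since \<gamma> > 0 on the type set, the utility is a strictly decreasing function of the
  certainty-equivalent cost, so comparing utilities amounts to reading off the sign of the
  gap.\<close>

lemma rule_at_iff_gap:
  "rule_at m q \<longleftrightarrow> q \<in> borel_measurable \<pi> \<and>
     (\<forall>\<theta>\<in>\<Theta>. q \<theta> \<in> {0..1} \<and> (gap \<theta> m < 0 \<longrightarrow> q \<theta> = 1) \<and> (0 < gap \<theta> m \<longrightarrow> q \<theta> = 0))"
  unfolding participation_rule_def space_pi U_in_def U_out_def gap_def CE_out_eq_CE_in e_out_eq_e_in
  using fst_pos by (intro conj_cong ball_cong refl) simp_all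

text \<open>This rule keeps indifferent types out; it witnesses that rules exist and later serves to
  define the aggregate map.\<close>

lemma rule_at_indicator:
  assumes "m \<in> {0..Emax}"
  shows "rule_at m (indicator {\<theta> \<in> \<Theta>. gap \<theta> m < 0})"
proof -
  note [measurable] = measurable_gap[OF assms]
  have "{\<theta> \<in> \<Theta>. gap \<theta> m < 0} \<in> sets \<pi>" unfolding space_pi[symmetric] by measurable
  thus ?thesis by (auto simp: rule_at_iff_gap indicator_def)
qed

text \<open>When the gaps at \<open>m\<close> and \<open>m'\<close> have the same strict sign, both
  rules prescribe the same value.\<close>

lemma rule_at_differ_imp_switching:
  assumes "rule_at m q" "rule_at m' q'" "\<theta> \<in> \<Theta>" "q \<theta> \<noteq> q' \<theta>"
  shows "\<theta> \<in> switching m m'"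
proof -
  have "\<not> (gap \<theta> m < 0 \<and> gap \<theta> m' < 0)" "\<not> (gap \<theta> m > 0 \<and> gap \<theta> m' > 0)"
    using assms unfolding rule_at_iff_gap by metis+
  thus ?thesis using assms(3) by (auto simp: switching_def)
qed

text \<open>Only indifferent types can be treated differently, and \<open>measure_switching\<close>
  with equal arguments gives them mass 0.\<close>

lemma rule_at_unique_AE:
  assumes "m \<in> {0..Emax}" "rule_at m q" "rule_at m q'"
  shows "AE \<theta> in \<pi>. q \<theta> = q' \<theta>"
proof (rule AE_I)
  show "{\<theta> \<in> space \<pi>. q \<theta> \<noteq> q' \<theta>} \<subseteq> switching m m"
    using rule_at_differ_imp_switching[OF assms(2,3)] by (auto simp: space_pi)
  have "measure \<pi> (switching m m) = 0"
    using measure_switching[OF assms(1) assms(1)] measure_nonneg[of \<pi> "switching m m"] by simp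
  thus "emeasure \<pi> (switching m m) = 0" by (simp add: pi.emeasure_eq_measure)
qed (rule sets_switching[OF assms(1) assms(1)])

abbreviation "mix m q \<theta> \<equiv> q \<theta> * ein \<theta> m + (1 - q \<theta>) * eout \<theta> m"

lemma mix_mem:
  assumes "m \<in> {0..Emax}" "rule_at m q" "\<theta> \<in> \<Theta>"
  shows "mix m q \<theta> \<in> {0..Emax}"
proof -
  have q: "0 \<le> q \<theta>" "q \<theta> \<le> 1" using assms by (auto simp: rule_at_iff_gap)
  show ?thesis
    using q ein_mem[OF assms(3,1)] eout_mem[OF assms(3,1)]
      convex_bound_le[of "ein \<theta> m" Emax "eout \<theta> m" "q \<theta>" "1 - q \<theta>"] by auto
qed

lemma integrable_mix:
  assumes "m \<in> {0..Emax}" "rule_at m q"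
  shows "integrable \<pi> (mix m q)"
proof (rule pi.integrable_const_bound[of _ Emax])
  show "AE \<theta> in \<pi>. norm (mix m q \<theta>) \<le> Emax"
    using mix_mem[OF assms] by (intro AE_I2) (simp add: space_pi)
  have [measurable]: "q \<in> borel_measurable \<pi>" using assms(2) by (simp add: rule_at_iff_gap)
  note [measurable] = measurable_ein[OF assms(1)] measurable_eout[OF assms(1)]
  show "mix m q \<in> borel_measurable \<pi>" by measurable
qed

lemma integral_mix_mem:
  assumes "m \<in> {0..Emax}" "rule_at m q"
  shows "(\<integral>\<theta>. mix m q \<theta> \<partial>\<pi>) \<in> {0..Emax}"
  using mix_mem[OF assms] integrable_mix[OF assms]
  by (auto simp: space_pi intro!: integral_nonneg_AE pi.integral_le_const AE_I2)

text \<open>The two rules are arbitrary and unrelated, so the case \<open>m = m'\<close> also shows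
  that the aggregate does not depend on the chosen rule.\<close>

lemma integral_mix_lipschitz:
  assumes m: "m \<in> {0..Emax}" "m' \<in> {0..Emax}" and q: "rule_at m q" "rule_at m' q'"
  shows "\<bar>(\<integral>\<theta>. mix m q \<theta> \<partial>\<pi>) - (\<integral>\<theta>. mix m' q' \<theta> \<partial>\<pi>)\<bar> \<le> (x + Emax * C_q) * \<bar>m - m'\<bar>"
proof -
  let ?S = "switching m m'"
  have S: "?S \<in> sets \<pi>" using sets_switching[OF m] .
  have pointwise: "\<bar>mix m q \<theta> - mix m' q' \<theta>\<bar> \<le> x * \<bar>m - m'\<bar> + Emax * indicator ?S \<theta>"
    if \<theta>: "\<theta> \<in> \<Theta>" for \<theta>
  proof -
    have q01: "0 \<le> q \<theta>" "q \<theta> \<le> 1" "0 \<le> q' \<theta>" "q' \<theta> \<le> 1"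
      using q \<theta> by (auto simp: rule_at_iff_gap)
    \<comment> \<open>The change is made in two stages: first the efforts move from \<open>m\<close>
      to \<open>m'\<close> under the weight \<open>q\<close>, then the weight changes to
      \<open>q'\<close> at the efforts for \<open>m'\<close>.\<close>
    have "\<bar>mix m q \<theta> - mix m' q' \<theta>\<bar> = \<bar>(q \<theta> * (ein \<theta> m - ein \<theta> m') + (1 - q \<theta>) * (eout \<theta> m - eout \<theta> m'))
        + (q \<theta> - q' \<theta>) * (ein \<theta> m' - eout \<theta> m')\<bar>"
      by (simp add: algebra_simps)
    also have "\<dots> \<le> (q \<theta> * \<bar>ein \<theta> m - ein \<theta> m'\<bar> + (1 - q \<theta>) * \<bar>eout \<theta> m - eout \<theta> m'\<bar>)
        + \<bar>q \<theta> - q' \<theta>\<bar> * \<bar>ein \<theta> m' - eout \<theta> m'\<bar>"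
      using q01
      by (intro order_trans[OF abs_triangle_ineq] add_mono) (simp_all add: abs_mult)
    \<comment> \<open>The first stage is a convex combination of effort changes. The second vanishes
      off the switching set and is at most \<open>Emax\<close> on it, as both efforts lie in
      \<open>{0..Emax}\<close>.\<close>
    also have "\<dots> \<le> x * \<bar>m - m'\<bar> + indicator ?S \<theta> * Emax"
    proof (intro add_mono mult_mono)
      show "q \<theta> * \<bar>ein \<theta> m - ein \<theta> m'\<bar> + (1 - q \<theta>) * \<bar>eout \<theta> m - eout \<theta> m'\<bar> \<le> x * \<bar>m - m'\<bar>"
        using q01 ein_lipschitz[OF \<theta> m] eout_lipschitz[OF \<theta> m] by (intro convex_bound_le) auto
      show "\<bar>q \<theta> - q' \<theta>\<bar> \<le> indicator ?S \<theta>"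
        using q01 rule_at_differ_imp_switching[OF q \<theta>] by (auto simp: indicator_def)
      show "\<bar>ein \<theta> m' - eout \<theta> m'\<bar> \<le> Emax"
        using ein_mem[OF \<theta> m(2)] eout_mem[OF \<theta> m(2)] by auto
    qed auto
    finally show ?thesis by (simp add: mult.commute)
  qed
  have ind: "integrable \<pi> (indicator ?S :: agent \<Rightarrow> real)"
    using S by (intro integrable_real_indicator) (auto simp: pi.emeasure_eq_measure)
  have "\<bar>(\<integral>\<theta>. mix m q \<theta> \<partial>\<pi>) - (\<integral>\<theta>. mix m' q' \<theta> \<partial>\<pi>)\<bar> = \<bar>\<integral>\<theta>. mix m q \<theta> - mix m' q' \<theta> \<partial>\<pi>\<bar>"
    using integrable_mix m q by simp
  also have "\<dots> \<le> (\<integral>\<theta>. \<bar>mix m q \<theta> - mix m' q' \<theta>\<bar> \<partial>\<pi>)"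
    by (rule integral_abs_bound)
  also have "\<dots> \<le> (\<integral>\<theta>. x * \<bar>m - m'\<bar> + Emax * indicator ?S \<theta> \<partial>\<pi>)"
    using ind pointwise integrable_mix m q
    by (intro integral_mono) (auto simp: space_pi)
  also have "\<dots> = x * \<bar>m - m'\<bar> + Emax * measure \<pi> ?S"
    using ind S pi.prob_space sets.sets_into_space[OF S] by (simp add: Int_absorb2)
  also have "\<dots> \<le> x * \<bar>m - m'\<bar> + Emax * (C_q * \<bar>m - m'\<bar>)"
    using measure_switching[OF m] Emax_nonneg by (intro add_left_mono mult_left_mono) auto
  also have "\<dots> = (x + Emax * C_q) * \<bar>m - m'\<bar>" by (simp add: algebra_simps)
  finally show ?thesis .
qed

section \<open>Equilibria as fixed points\<close>

text \<open>Singleton optimal-effort sets determine \<open>ei\<close> and \<open>eo\<close> at every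
  type, so the participation rule and the consistency condition can be restated for the canonical
  efforts.\<close>

lemma mean_field_equilibriumD:
  assumes "mean_field_equilibrium \<mu> lam x Emax p \<alpha> \<beta> \<pi> m ei eo q"
  shows "m \<in> {0..Emax}" "rule_at m q" "\<And>\<theta>. \<theta> \<in> \<Theta> \<Longrightarrow> ei \<theta> = ein \<theta> m" "\<And>\<theta>. \<theta> \<in> \<Theta> \<Longrightarrow> eo \<theta> = eout \<theta> m"
    "m = (\<integral>\<theta>. mix m q \<theta> \<partial>\<pi>)"
proof -
  note eq = assms[unfolded mean_field_equilibrium_def]
  show m: "m \<in> {0..Emax}" using eq by blast
  show e: "ei \<theta> = ein \<theta> m" "eo \<theta> = eout \<theta> m" if "\<theta> \<in> \<Theta>" for \<theta>
    using eq E_in_eq[OF that m] E_out_eq[OF that m] that by (auto simp: space_pi)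
  show "rule_at m q"
    using eq e by (auto simp: participation_rule_def space_pi)
  have "(\<integral>\<theta>. q \<theta> * ei \<theta> + (1 - q \<theta>) * eo \<theta> \<partial>\<pi>) = (\<integral>\<theta>. mix m q \<theta> \<partial>\<pi>)"
    by (intro Bochner_Integration.integral_cong refl) (simp add: e space_pi)
  thus "m = (\<integral>\<theta>. mix m q \<theta> \<partial>\<pi>)" using eq by linarith
qed

lemma mean_field_equilibriumI:
  assumes "m \<in> {0..Emax}" "rule_at m q" "m = (\<integral>\<theta>. mix m q \<theta> \<partial>\<pi>)"
  shows "mean_field_equilibrium \<mu> lam x Emax p \<alpha> \<beta> \<pi> m (\<lambda>\<theta>. ein \<theta> m) (\<lambda>\<theta>. eout \<theta> m) q"
  unfolding mean_field_equilibrium_def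
proof (intro conjI ballI)
  fix \<theta> assume "\<theta> \<in> space \<pi>"
  thus "eout \<theta> m \<in> E_out \<mu> lam x Emax \<theta> m" "ein \<theta> m \<in> E_in \<mu> lam x Emax p \<alpha> \<beta> \<theta> m"
    using E_in_eq E_out_eq assms(1) by (simp_all add: space_pi)
qed (fact assms measurable_ein[OF assms(1)] measurable_eout[OF assms(1)])+

lemma integrable_between:
  assumes "g \<in> borel_measurable \<pi>" "\<And>\<theta>. \<theta> \<in> \<Theta> \<Longrightarrow> g \<theta> \<in> {0..b::real}"
  shows "integrable \<pi> g"
  using assms by (intro pi.integrable_const_bound[of _ b] AE_I2) (auto simp: space_pi)

end

section \<open>Contraction of the aggregate map and uniqueness of the equilibrium\<close>

theorem theorem3p2:
  fixes x Emax p \<alpha> \<beta> L_mu L_lam C_f c_sigma C_m C_q :: real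
    and \<gamma>_min \<gamma>_max c_max \<sigma>_min \<sigma>_max :: real
    and \<mu> lam :: "real \<Rightarrow> real"
    and \<Theta> :: "agent set"
    and \<pi> :: "agent measure"
    and f :: "agent \<Rightarrow> real"
  assumes x: "0 \<le> x" "x < 1"
    and lam_nonneg: "\<And>z. 0 \<le> z \<Longrightarrow> 0 \<le> lam z"
    and p: "0 \<le> p"
    and U1: "0 \<le> Emax"
    and U2_cont: "continuous_on {0..(1 + x) * Emax} \<mu>" "continuous_on {0..(1 + x) * Emax} lam"
    and U2_convex: "strictly_convex_on {0..(1 + x) * Emax} \<mu>"
      "strictly_convex_on {0..(1 + x) * Emax} lam"
    and U2_L: "0 < L_mu" "0 < L_lam"
    and U2_mu: "\<And>z1 z2. z1 \<in> {0..(1 + x) * Emax} \<Longrightarrow> z2 \<in> {0..(1 + x) * Emax} \<Longrightarrow>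
      \<bar>\<mu> z1 - \<mu> z2\<bar> \<le> L_mu * \<bar>z1 - z2\<bar>"
    and U2_lam: "\<And>z1 z2. z1 \<in> {0..(1 + x) * Emax} \<Longrightarrow> z2 \<in> {0..(1 + x) * Emax} \<Longrightarrow>
      \<bar>lam z1 - lam z2\<bar> \<le> L_lam * \<bar>z1 - z2\<bar>"
    and U3: "0 < \<gamma>_min" "\<gamma>_min < \<gamma>_max" "0 < c_max" "0 < \<sigma>_min" "\<sigma>_min < \<sigma>_max"
    and Theta: "\<Theta> = {\<gamma>_min..\<gamma>_max} \<times> {0..c_max} \<times> {\<sigma>_min..\<sigma>_max}"
    and U4: "0 < \<alpha>" "0 \<le> \<beta>" "\<beta> < 1"
    and prob: "prob_space \<pi>"
    and U5_f: "f \<in> borel_measurable (restrict_space lborel \<Theta>)" "\<And>\<theta>. \<theta> \<in> \<Theta> \<Longrightarrow> 0 \<le> f \<theta>"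
    and U5_density: "\<pi> = density (restrict_space lborel \<Theta>) (\<lambda>\<theta>. ennreal (f \<theta>))"
    and U5_bound: "esssup (restrict_space lborel \<Theta>) (\<lambda>\<theta>. ereal \<bar>f \<theta>\<bar>) \<le> ereal C_f"
    and c_sigma: "c_sigma = \<gamma>_min * \<alpha>\<^sup>2 * \<sigma>_min"
    and C_m: "C_m = x * (2 * c_max + \<alpha> + (2 - \<beta>) * L_mu
                          + 1/2 * \<gamma>_max * ((1 - \<beta>)\<^sup>2 + 1) * L_lam)"
    and C_q: "C_q = C_f / c_sigma * (\<gamma>_max - \<gamma>_min) * c_max * C_m"
    and U6: "3 * x + Emax * C_q < 1"
  shows
    "(\<forall>\<theta>\<in>\<Theta>. \<forall>m\<in>{0..Emax}.
        is_singleton (E_in \<mu> lam x Emax p \<alpha> \<beta> \<theta> m) \<and> is_singleton (E_out \<mu> lam x Emax \<theta> m))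
     \<and>
     (\<exists>\<Phi> :: real \<Rightarrow> real.
        \<Phi> \<in> {0..Emax} \<rightarrow> {0..Emax} \<and>
        (\<forall>m\<in>{0..Emax}.
           (\<exists>q. participation_rule \<mu> lam x p \<alpha> \<beta> \<pi> m
                  (\<lambda>\<theta>. e_in \<mu> lam x Emax p \<alpha> \<beta> \<theta> m) (\<lambda>\<theta>. e_out \<mu> lam x Emax \<theta> m) q) \<and>
           (\<forall>q. participation_rule \<mu> lam x p \<alpha> \<beta> \<pi> m
                  (\<lambda>\<theta>. e_in \<mu> lam x Emax p \<alpha> \<beta> \<theta> m) (\<lambda>\<theta>. e_out \<mu> lam x Emax \<theta> m) q \<longrightarrow>
              integrable \<pi> (\<lambda>\<theta>. q \<theta> * e_in \<mu> lam x Emax p \<alpha> \<beta> \<theta> m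
                                + (1 - q \<theta>) * e_out \<mu> lam x Emax \<theta> m) \<and>
              \<Phi> m = (\<integral>\<theta>. q \<theta> * e_in \<mu> lam x Emax p \<alpha> \<beta> \<theta> m
                          + (1 - q \<theta>) * e_out \<mu> lam x Emax \<theta> m \<partial>\<pi>))) \<and>
        (\<exists>L<1. L-lipschitz_on {0..Emax} \<Phi>) \<and>
        complete {0..Emax} \<and>
        (\<exists>!m. m \<in> {0..Emax} \<and> m = \<Phi> m) \<and>
        (\<forall>m\<in>{0..Emax}. m = \<Phi> m \<longrightarrow>
           (\<exists>ei eo q. mean_field_equilibrium \<mu> lam x Emax p \<alpha> \<beta> \<pi> m ei eo q)) \<and>
        (\<forall>m ei eo q m' ei' eo' q'.
           mean_field_equilibrium \<mu> lam x Emax p \<alpha> \<beta> \<pi> m ei eo q \<longrightarrow>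
           mean_field_equilibrium \<mu> lam x Emax p \<alpha> \<beta> \<pi> m' ei' eo' q' \<longrightarrow>
             m = \<Phi> m \<and> m = m' \<and>
             (AE \<theta> in \<pi>. ei \<theta> = ei' \<theta> \<and> eo \<theta> = eo' \<theta> \<and> q \<theta> = q' \<theta>) \<and>
             integrable \<pi> ei \<and> integrable \<pi> eo \<and> integrable \<pi> q \<and>
             (\<integral>\<theta>. ei \<theta> \<partial>\<pi>) = (\<integral>\<theta>. ei' \<theta> \<partial>\<pi>) \<and>
             (\<integral>\<theta>. eo \<theta> \<partial>\<pi>) = (\<integral>\<theta>. eo' \<theta> \<partial>\<pi>) \<and>
             (\<integral>\<theta>. q \<theta> \<partial>\<pi>) = (\<integral>\<theta>. q' \<theta> \<partial>\<pi>) \<and>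
             (\<forall>h :: agent \<times> real \<times> real \<times> real \<Rightarrow> real.
                h \<in> borel_measurable (\<pi> \<Otimes>\<^sub>M borel \<Otimes>\<^sub>M borel \<Otimes>\<^sub>M borel) \<longrightarrow>
                (integrable \<pi> (\<lambda>\<theta>. h (\<theta>, ei \<theta>, eo \<theta>, q \<theta>)) \<longleftrightarrow>
                 integrable \<pi> (\<lambda>\<theta>. h (\<theta>, ei' \<theta>, eo' \<theta>, q' \<theta>))) \<and>
                (\<integral>\<theta>. h (\<theta>, ei \<theta>, eo \<theta>, q \<theta>) \<partial>\<pi>) =
                (\<integral>\<theta>. h (\<theta>, ei' \<theta>, eo' \<theta>, q' \<theta>) \<partial>\<pi>))))"
proof -
  interpret insurance_game \<mu> lam x Emax L_mu L_lam p \<alpha> \<beta> C_f c_sigma C_m C_q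
      \<gamma>_min \<gamma>_max c_max \<sigma>_min \<sigma>_max \<Theta> \<pi> f
    by (intro insurance_game.intro convex_effort_costs.intro insurance_game_axioms.intro)
      (fact assms less_imp_le[OF U2_L(1)] less_imp_le[OF U2_L(2)])+
  define \<Phi> where "\<Phi> m = (\<integral>\<theta>. mix m (indicator {\<theta> \<in> \<Theta>. gap \<theta> m < 0}) \<theta> \<partial>\<pi>)" for m
  \<comment> \<open>At equal arguments the Lipschitz bound is 0, so every rule at \<open>m\<close>
    yields the same integral as the one that keeps indifferent types out.\<close>
  have \<Phi>_eq: "\<Phi> m = (\<integral>\<theta>. mix m q \<theta> \<partial>\<pi>)" if "m \<in> {0..Emax}" "rule_at m q" for m q
    using integral_mix_lipschitz[OF that(1) that(1) rule_at_indicator[OF that(1)] that(2)]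
    by (simp add: \<Phi>_def)
  have \<Phi>_mem: "\<Phi> m \<in> {0..Emax}" if "m \<in> {0..Emax}" for m
    using integral_mix_mem[OF that rule_at_indicator[OF that]] by (simp add: \<Phi>_def)
  \<comment> \<open>The strict bound follows from \<open>U6\<close>, because
    \<open>x \<le> 3 * x\<close> for nonnegative \<open>x\<close>.\<close>
  have L: "0 \<le> x + Emax * C_q" "x + Emax * C_q < 1"
    using x U6 C_q_nonneg Emax_nonneg by auto
  have lip: "(x + Emax * C_q)-lipschitz_on {0..Emax} \<Phi>"
    using L integral_mix_lipschitz rule_at_indicator
    by (intro lipschitz_onI) (auto simp: dist_real_def \<Phi>_def)
  have complete: "complete {0..Emax}" by (intro compact_imp_complete compact_Icc)
  have "\<exists>!m\<in>{0..Emax}. \<Phi> m = m"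
    using \<Phi>_mem lip U1 by (intro Banach_fix[OF complete _ L]) (auto simp: lipschitz_on_def)
  hence fixpoint: "\<exists>!m. m \<in> {0..Emax} \<and> m = \<Phi> m"
    by metis
  have eq_fix: "m = \<Phi> m" if "mean_field_equilibrium \<mu> lam x Emax p \<alpha> \<beta> \<pi> m ei eo q" for m ei eo q
    using mean_field_equilibriumD(5)[OF that] \<Phi>_eq[OF mean_field_equilibriumD(1,2)[OF that]]
    by (rule trans_sym)
  show ?thesis
  proof (intro conjI exI[of _ \<Phi>] ballI allI impI)
    fix \<theta> m assume "\<theta> \<in> \<Theta>" "m \<in> {0..Emax}"
    thus "is_singleton (E_in \<mu> lam x Emax p \<alpha> \<beta> \<theta> m)" "is_singleton (E_out \<mu> lam x Emax \<theta> m)"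
      using E_in_eq E_out_eq by simp_all
  next
    show "\<Phi> \<in> {0..Emax} \<rightarrow> {0..Emax}" using \<Phi>_mem by blast
  next
    fix m assume m: "m \<in> {0..Emax}"
    show "\<exists>q. rule_at m q" using rule_at_indicator[OF m] by blast
    show "integrable \<pi> (mix m q)" "\<Phi> m = (\<integral>\<theta>. mix m q \<theta> \<partial>\<pi>)" if "rule_at m q" for q
      using integrable_mix[OF m that] \<Phi>_eq[OF m that] .
    show "\<exists>ei eo q. mean_field_equilibrium \<mu> lam x Emax p \<alpha> \<beta> \<pi> m ei eo q" if "m = \<Phi> m"
      using mean_field_equilibriumI[OF m rule_at_indicator[OF m]] that unfolding \<Phi>_def by blast
  next
    show "\<exists>L<1. L-lipschitz_on {0..Emax} \<Phi>" using L lip by blast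
  next
    fix m ei eo q m' ei' eo' q'
    assume eq: "mean_field_equilibrium \<mu> lam x Emax p \<alpha> \<beta> \<pi> m ei eo q"
      and eq': "mean_field_equilibrium \<mu> lam x Emax p \<alpha> \<beta> \<pi> m' ei' eo' q'"
    note D = mean_field_equilibriumD[OF eq] and D' = mean_field_equilibriumD[OF eq']
    show "m = \<Phi> m" using eq_fix[OF eq] .
    show m_eq: "m = m'" using fixpoint eq_fix[OF eq] eq_fix[OF eq'] D(1) D'(1) by blast
    have "AE \<theta> in \<pi>. q \<theta> = q' \<theta>" using rule_at_unique_AE D(1,2) D'(2) m_eq by blast
    \<comment> \<open>The efforts agree at every type; an exceptional null set arises only for the
      participation probabilities, at indifferent types.\<close>
    moreover have "AE \<theta> in \<pi>. ei \<theta> = ei' \<theta> \<and> eo \<theta> = eo' \<theta>"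
      using D(3,4) D'(3,4) m_eq by (intro AE_I2) (simp add: space_pi)
    ultimately show ae: "AE \<theta> in \<pi>. ei \<theta> = ei' \<theta> \<and> eo \<theta> = eo' \<theta> \<and> q \<theta> = q' \<theta>"
      by eventually_elim simp
    have meas [measurable]: "ei \<in> borel_measurable \<pi>" "eo \<in> borel_measurable \<pi>" "q \<in> borel_measurable \<pi>"
      "ei' \<in> borel_measurable \<pi>" "eo' \<in> borel_measurable \<pi>" "q' \<in> borel_measurable \<pi>"
      using eq eq' by (auto simp: mean_field_equilibrium_def participation_rule_def)
    show "integrable \<pi> ei" using D(3) ein_mem[OF _ D(1)] by (intro integrable_between[of _ Emax] meas) simp
    show "integrable \<pi> eo" using D(4) eout_mem[OF _ D(1)] by (intro integrable_between[of _ Emax] meas) simp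
    show "integrable \<pi> q"
      using D(2) unfolding rule_at_iff_gap by (intro integrable_between[of _ 1] meas) simp
    show "(\<integral>\<theta>. ei \<theta> \<partial>\<pi>) = (\<integral>\<theta>. ei' \<theta> \<partial>\<pi>)" "(\<integral>\<theta>. eo \<theta> \<partial>\<pi>) = (\<integral>\<theta>. eo' \<theta> \<partial>\<pi>)"
      "(\<integral>\<theta>. q \<theta> \<partial>\<pi>) = (\<integral>\<theta>. q' \<theta> \<partial>\<pi>)"
      by (intro integral_cong_AE meas; use ae in eventually_elim; simp)+
    \<comment> \<open>An arbitrary aggregate of the type and the equilibrium objects. The equality
      of integrals includes the non-integrable case, in which both are 0 by convention.\<close>
    fix h :: "agent \<times> real \<times> real \<times> real \<Rightarrow> real"
    assume [measurable]: "h \<in> borel_measurable (\<pi> \<Otimes>\<^sub>M borel \<Otimes>\<^sub>M borel \<Otimes>\<^sub>M borel)"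
    have h_meas: "(\<lambda>\<theta>. h (\<theta>, ei \<theta>, eo \<theta>, q \<theta>)) \<in> borel_measurable \<pi>"
      "(\<lambda>\<theta>. h (\<theta>, ei' \<theta>, eo' \<theta>, q' \<theta>)) \<in> borel_measurable \<pi>"
      by measurable
    have h_ae: "AE \<theta> in \<pi>. h (\<theta>, ei \<theta>, eo \<theta>, q \<theta>) = h (\<theta>, ei' \<theta>, eo' \<theta>, q' \<theta>)"
      using ae by eventually_elim simp
    show "integrable \<pi> (\<lambda>\<theta>. h (\<theta>, ei \<theta>, eo \<theta>, q \<theta>)) \<longleftrightarrow>
        integrable \<pi> (\<lambda>\<theta>. h (\<theta>, ei' \<theta>, eo' \<theta>, q' \<theta>))"
      by (rule integrable_cong_AE[OF h_meas h_ae])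
    show "(\<integral>\<theta>. h (\<theta>, ei \<theta>, eo \<theta>, q \<theta>) \<partial>\<pi>) = (\<integral>\<theta>. h (\<theta>, ei' \<theta>, eo' \<theta>, q' \<theta>) \<partial>\<pi>)"
      by (rule integral_cong_AE[OF h_meas h_ae])
  qed (fact complete fixpoint)+
qed

end
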